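(* Fix $n\in\mathbb Z_{\ge2}$ and $k\in\mathbb Z_{\ge1}$, and let $\searrow_n=n(n-1)\cdots1$. Then $$\dim P^{\mathrm{Av}(\searrow_n)}_k=|\mathrm{Av}_k(\searrow_n)|-|\mathrm{Av}_{k-1}(\searrow_n)|.$$
   Context: $\mathcal S_m$ is the set of permutations of $[m]$. For $I=\{i_1<\dots<i_m\}$, $\mathrm{pat}_I(\sigma)$ is the unique permutation with entries in the same relative order as $\sigma(i_1),\dots,\sigma(i_m)$. $\sigma$ avoids $\pi$ if no $I$ has $\mathrm{pat}_I(\sigma)=\pi$; $\mathrm{Av}_m(\searrow_n)$ is the set of size-$m$ permutations avoiding $\searrow_n$, with $\mathrm{Av}_0(\searrow_n)$ consisting of the empty permutation, and $\mathrm{Av}(\searrow_n)=\bigcup_{m\ge1}\mathrm{Av}_m(\searrow_n)$. For $\pi\in\mathcal S_k,\sigma\in\mathcal S_m$, $\widetilde{\mathrm{c\text{-}occ}}(\pi,\sigma)$ is $1/m$ times the number of intervals $I=\{i,\dots,i+k-1\}$ with $\mathrm{pat}_I(\sigma)=\pi$. $P^{\mathrm{Av}(\searrow_n)}_k$ is the set of $\vec v\in[0,1]^{\mathcal S_k}$ for which there is a sequence $(\sigma^m)$ in $\mathrm{Av}(\searrow_n)$ with $|\sigma^m|\to\infty$ and $\widetilde{\mathrm{c\text{-}occ}}(\pi,\sigma^m)\to\vec v_\pi$ for all $\pi\in\mathcal S_k$. This set is convex; its dimension is the dimension of its affine hull. *)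

theory Defs
  imports "HOL-Analysis.Analysis" "HOL-Library.Function_Algebras"
          "HOL-Combinatorics.Multiset_Permutations"
begin

definition Sym :: "nat \<Rightarrow> nat list set" where
  "Sym m = permutations_of_set {1..m}"

text \<open>Standardisation: the permutation of [length xs] with entries in the same
  relative order as xs (xs assumed to have distinct entries).\<close>
definition std :: "nat list \<Rightarrow> nat list" where
  "std xs = map (\<lambda>x. card {y \<in> set xs. y \<le> x}) xs"

text \<open>pat_I(sigma) for an index set I (0-based positions), read in increasing order.\<close>
definition pat :: "nat set \<Rightarrow> nat list \<Rightarrow> nat list" where
  "pat I \<sigma> = std (nths \<sigma> I)"

definition avoids :: "nat list \<Rightarrow> nat list \<Rightarrow> bool" where
  "avoids \<sigma> \<pi> \<longleftrightarrow> \<not> (\<exists>I. I \<subseteq> {0..<length \<sigma>} \<and> card I = length \<pi> \<and> pat I \<sigma> = \<pi>)"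

definition decr :: "nat \<Rightarrow> nat list" where
  "decr n = rev [1..<n+1]"

definition Av_m :: "nat \<Rightarrow> nat list \<Rightarrow> nat list set" where
  "Av_m m \<pi> = {\<sigma> \<in> Sym m. avoids \<sigma> \<pi>}"

definition Av :: "nat list \<Rightarrow> nat list set" where
  "Av \<pi> = (\<Union>m\<in>{1..}. Av_m m \<pi>)"

definition cocc :: "nat list \<Rightarrow> nat list \<Rightarrow> real" where
  "cocc \<pi> \<sigma> = real (card {i. i + length \<pi> \<le> length \<sigma> \<and>
       pat {i..<i + length \<pi>} \<sigma> = \<pi>}) / real (length \<sigma>)"

text \<open>Feasible region P_k^C of a class C. Vectors in [0,1]^(S_k) are represented
  as functions nat list => real that vanish outside S_k.\<close>
definition feasible_region :: "nat list set \<Rightarrow> nat \<Rightarrow> (nat list \<Rightarrow> real) set" where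
  "feasible_region C k = {v. (\<forall>\<pi>. \<pi> \<notin> Sym k \<longrightarrow> v \<pi> = 0) \<and> (\<forall>\<pi>\<in>Sym k. v \<pi> \<in> {0..1}) \<and>
     (\<exists>\<sigma> :: nat \<Rightarrow> nat list. (\<forall>j. \<sigma> j \<in> C) \<and>
        filterlim (\<lambda>j. length (\<sigma> j)) at_top sequentially \<and>
        (\<forall>\<pi>\<in>Sym k. (\<lambda>j. cocc \<pi> (\<sigma> j)) \<longlonglongrightarrow> v \<pi>))}"

definition fun_aff_dim :: "('a \<Rightarrow> real) set \<Rightarrow> int" where
  "fun_aff_dim S = (if S = {} then -1 else
     int (vector_space.dim (\<lambda>c (f :: 'a \<Rightarrow> real) x. c * f x)
           ((\<lambda>x. x - (SOME a. a \<in> S)) ` S)))"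

end

theory Submission
  imports Defs "HOL-Library.Sublist"
begin

text \<open>
  Consecutive patterns of a permutation trace a walk in the overlap graph with vertices
  \<open>Av\<^sub>k\<^sub>-\<^sub>1\<close> and edges \<open>Av\<^sub>k\<close>, so feasible vectors are flows of total mass one; this graph is
  connected, hence flows of total mass zero form a space of dimension \<open>|Av\<^sub>k| - |Av\<^sub>k\<^sub>-\<^sub>1|\<close>.
  Conversely, the class is closed under direct sums, so the closed walk \<open>W \<rho>\<close> of
  \<open>id \<oplus> \<rho> \<oplus> id\<close>, where \<open>id\<close> is the identity of size \<open>k - 1\<close>, is feasible after normalisation.
  Let \<open>G \<rho>\<close> be the walk of \<open>id \<oplus> \<rho>\<close>. For an edge \<open>\<pi>\<close> from \<open>\<rho>\<close> to \<open>\<rho>'\<close>, the walks \<open>W \<pi>\<close> and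
  \<open>W \<rho>'\<close> share their final part, whence \<open>W \<pi> - W \<rho>' = e\<^sub>\<pi> + G \<rho> - G \<rho>'\<close>. Summing against a
  flow \<open>x\<close> cancels the \<open>G\<close> terms, so \<open>x\<close> lies in the span of the feasible vectors.
\<close>

section \<open>Standardisation\<close>

lemma length_std [simp]: "length (std xs) = length xs"
  by (simp add: std_def)

lemma std_map:
  assumes "strict_mono_on (set xs) f"
  shows "std (map f xs) = std xs"
proof -
  have "card {y \<in> f ` set xs. y \<le> f x} = card {y \<in> set xs. y \<le> x}" if "x \<in> set xs" for x
  proof -
    have "{y \<in> f ` set xs. y \<le> f x} = f ` {y \<in> set xs. y \<le> x}"
      using assms that by (auto simp: strict_mono_on_leD strict_mono_on_less_eq)
    moreover have "inj_on f {y \<in> set xs. y \<le> x}"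
      using strict_mono_on_imp_inj_on[OF assms] by (auto simp: inj_on_def)
    ultimately show ?thesis by (simp add: card_image)
  qed
  then show ?thesis by (simp add: std_def)
qed

text \<open>The rank function is itself strictly monotone. Keeping only an abstract \<open>r\<close>
  lets later facts about \<open>std\<close> follow by transport along monotone maps.\<close>

lemma std_conv_map:
  obtains r where "std xs = map r xs" "strict_mono_on (set xs) r"
proof
  show "std xs = map (\<lambda>x. card {y \<in> set xs. y \<le> x}) xs"
    by (simp add: std_def)
  show "strict_mono_on (set xs) (\<lambda>x. card {y \<in> set xs. y \<le> x})"
    by (intro strict_mono_onI psubset_card_mono) (auto simp: psubset_eq dest: leD)
qed

lemma std_take_std: "std (take m (std xs)) = std (take m xs)"
proof -
  obtain r where r: "std xs = map r xs" "strict_mono_on (set xs) r"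
    by (rule std_conv_map)
  have "strict_mono_on (set (take m xs)) r"
    using r(2) by (rule monotone_on_subset) (rule set_take_subset)
  then show ?thesis by (simp add: r(1) take_map std_map)
qed

lemma std_drop_std: "std (drop m (std xs)) = std (drop m xs)"
proof -
  obtain r where r: "std xs = map r xs" "strict_mono_on (set xs) r"
    by (rule std_conv_map)
  have "strict_mono_on (set (drop m xs)) r"
    using r(2) by (rule monotone_on_subset) (rule set_drop_subset)
  then show ?thesis by (simp add: r(1) drop_map std_map)
qed

lemma Sym_iff: "xs \<in> Sym m \<longleftrightarrow> set xs = {1..m} \<and> distinct xs"
  by (auto simp: Sym_def permutations_of_set_def)

lemma length_Sym: "xs \<in> Sym m \<Longrightarrow> length xs = m"
  using distinct_card[of xs] by (simp add: Sym_iff)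

lemma finite_Sym [simp]: "finite (Sym m)"
  by (simp add: Sym_def)

text \<open>Distinct entries have distinct ranks between 1 and \<open>length xs\<close>, so by
  counting the ranks fill that interval.\<close>

lemma std_in_Sym:
  assumes "distinct xs"
  shows "std xs \<in> Sym (length xs)"
proof -
  obtain r where r: "std xs = map r xs" "strict_mono_on (set xs) r"
    by (rule std_conv_map)
  have d: "distinct (std xs)"
    using assms strict_mono_on_imp_inj_on[OF r(2)] by (simp add: r(1) distinct_map)
  have "set (std xs) \<subseteq> {1..length xs}"
  proof
    fix z assume "z \<in> set (std xs)"
    then obtain x where x: "x \<in> set xs" "z = card {y \<in> set xs. y \<le> x}"
      by (auto simp: std_def)
    have "z \<le> card (set xs)" unfolding x(2) by (rule card_mono) auto
    have "card {y \<in> set xs. y \<le> x} \<noteq> 0" using x(1) by auto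
    then have "1 \<le> z" unfolding x(2) by linarith
    then show "z \<in> {1..length xs}" using \<open>z \<le> card (set xs)\<close> distinct_card[OF assms] by simp
  qed
  moreover have "card (set (std xs)) = card {1..length xs}"
    using distinct_card[OF d] by simp
  ultimately have "set (std xs) = {1..length xs}"
    by (intro card_subset_eq) auto
  then show ?thesis using d by (simp add: Sym_iff)
qed

lemma std_Sym:
  assumes "xs \<in> Sym m"
  shows "std xs = xs"
proof -
  have "card {y \<in> set xs. y \<le> x} = x" if "x \<in> set xs" for x
  proof -
    have "{y \<in> set xs. y \<le> x} = {1..x}" using assms that by (auto simp: Sym_iff)
    then show ?thesis by simp
  qed
  then show ?thesis by (simp add: std_def map_idI)
qed

section \<open>Direct sums and identity permutations\<close>

definition dirsum :: "nat list \<Rightarrow> nat list \<Rightarrow> nat list" where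
  "dirsum xs ys = xs @ map (\<lambda>y. y + length xs) ys"

lemma length_dirsum [simp]: "length (dirsum xs ys) = length xs + length ys"
  by (simp add: dirsum_def)

lemma dirsum_assoc: "dirsum (dirsum xs ys) zs = dirsum xs (dirsum ys zs)"
  by (simp add: dirsum_def add.assoc add.commute add.left_commute)

lemma dirsum_Sym:
  assumes "xs \<in> Sym a" "ys \<in> Sym b"
  shows "dirsum xs ys \<in> Sym (a + b)"
proof -
  have "{1..a + b} = {1..a} \<union> (\<lambda>y. y + a) ` {1..b}"
    unfolding image_add_atLeastAtMost' by auto
  then show ?thesis
    using assms length_Sym[OF assms(1)] by (auto simp: Sym_iff dirsum_def distinct_map)
qed

text \<open>Ranks in \<open>xs\<close> do not see the larger entries of \<open>ys\<close>, while all
  of \<open>xs\<close> lies below each entry of \<open>ys\<close> and raises its rank by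
  \<open>length xs\<close>.\<close>

lemma std_append:
  assumes "distinct xs" "\<forall>x\<in>set xs. \<forall>y\<in>set ys. x < y"
  shows "std (xs @ ys) = dirsum (std xs) (std ys)"
proof -
  have 1: "card {y \<in> set (xs @ ys). y \<le> x} = card {y \<in> set xs. y \<le> x}" if "x \<in> set xs" for x
    using assms(2) that by (intro arg_cong[where f = card]) (auto dest: leD)
  have 2: "card {y \<in> set (xs @ ys). y \<le> x} = card {y \<in> set ys. y \<le> x} + length xs"
    if "x \<in> set ys" for x
  proof -
    have "{y \<in> set (xs @ ys). y \<le> x} = {y \<in> set ys. y \<le> x} \<union> set xs"
      using assms(2) that by (auto intro: less_imp_le)
    moreover have "{y \<in> set ys. y \<le> x} \<inter> set xs = {}"
      using assms(2) by fastforce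
    ultimately show ?thesis
      using distinct_card[OF assms(1)] by (simp add: card_Un_disjoint)
  qed
  show ?thesis
    using 1 2 by (simp add: std_def dirsum_def del: set_append)
qed

definition ident :: "nat \<Rightarrow> nat list" where
  "ident j = [1..<Suc j]"

lemma length_ident [simp]: "length (ident j) = j"
  by (simp add: ident_def)

lemma ident_Sym: "ident j \<in> Sym j"
  by (auto simp: ident_def Sym_iff)

section \<open>Avoiding a decreasing pattern\<close>

text \<open>Phrased for arbitrary lists and subsequences, so that it passes to windows and blocks
  without standardising; \<open>Av_m_decr\<close> links it to \<open>avoids\<close>.\<close>

definition dec_free :: "nat \<Rightarrow> nat list \<Rightarrow> bool" where
  "dec_free n xs \<longleftrightarrow> (\<forall>ys. subseq ys xs \<longrightarrow> sorted_wrt (>) ys \<longrightarrow> length ys \<noteq> n)"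

lemma dec_free_subseq: "dec_free n xs \<Longrightarrow> subseq ys xs \<Longrightarrow> dec_free n ys"
  unfolding dec_free_def by (blast intro: subseq_order.order_trans)

lemma dec_free_map:
  assumes "strict_mono_on (set xs) f" "dec_free n xs"
  shows "dec_free n (map f xs)"
  unfolding dec_free_def
proof (intro allI impI)
  fix ys assume ys: "subseq ys (map f xs)" "sorted_wrt (>) ys"
  then obtain N where N: "ys = map f (nths xs N)"
    by (auto simp: subseq_conv_nths nths_map)
  have sub: "subseq (nths xs N) xs" by (auto simp: subseq_conv_nths)
  have "sorted_wrt (>) (nths xs N)"
    using ys(2) unfolding N sorted_wrt_map
    by (rule sorted_wrt_mono_rel[rotated])
      (use set_nths_subset[of xs N] strict_mono_on_less[OF assms(1)] in auto)
  then show "length ys \<noteq> n"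
    using assms(2) sub by (auto simp: dec_free_def N)
qed

lemma dec_free_std: "dec_free n xs \<Longrightarrow> dec_free n (std xs)"
  by (metis std_conv_map dec_free_map)

text \<open>A decreasing subsequence cannot meet both blocks, because every entry of the first block
  is smaller than every entry of the second.\<close>

lemma dec_free_dirsum:
  assumes "dec_free n xs" "dec_free n ys" "xs \<in> Sym a" "ys \<in> Sym b"
  shows "dec_free n (dirsum xs ys)"
  unfolding dec_free_def
proof (intro allI impI)
  let ?ys = "map (\<lambda>y. y + length xs) ys"
  fix zs assume "subseq zs (dirsum xs ys)" and dec: "sorted_wrt (>) zs"
  then obtain us vs where zs: "zs = us @ vs" "subseq us xs" "subseq vs ?ys"
    unfolding dirsum_def by (elim subseq_appendE)
  have free: "dec_free n ?ys"
    using assms(2) by (intro dec_free_map) (auto simp: strict_mono_on_def)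
  have sub: "set us \<subseteq> set xs" "set vs \<subseteq> set ?ys"
    using zs(2,3) set_nths_subset unfolding subseq_conv_nths by metis+
  have "u < v" if "u \<in> set us" "v \<in> set vs" for u v
    using subsetD[OF sub(1) that(1)] subsetD[OF sub(2) that(2)]
      assms(3,4) length_Sym[OF assms(3)] by (auto simp: Sym_iff)
  moreover have "u > v" if "u \<in> set us" "v \<in> set vs" for u v
    using dec that by (auto simp: zs(1) sorted_wrt_append)
  ultimately have "us = [] \<or> vs = []"
    by (metis less_asym last_in_set)
  then show "length zs \<noteq> n"
    using zs dec assms(1) free by (auto simp: dec_free_def)
qed

text \<open>Single entries count as decreasing, which is why \<open>n \<ge> 2\<close> is
  required.\<close>

lemma dec_free_ident:
  assumes "n \<ge> 2"
  shows "dec_free n (ident j)"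
  unfolding dec_free_def
proof (intro allI impI)
  fix ys assume "subseq ys (ident j)" and dec: "sorted_wrt (>) ys"
  then have "sorted ys"
    by (auto simp: subseq_conv_nths ident_def simp del: upt_Suc intro!: sorted_nths)
  then have "length ys \<le> 1"
    using dec by (cases ys; cases "tl ys") auto
  then show "length ys \<noteq> n" using assms by simp
qed

lemma length_decr [simp]: "length (decr n) = n"
  by (simp add: decr_def del: upt_Suc)

text \<open>Standardising preserves order, and a strictly decreasing list is determined by its set,
  here \<open>{1..n}\<close>.\<close>

lemma std_eq_decr_iff:
  assumes "distinct ys"
  shows "std ys = decr n \<longleftrightarrow> length ys = n \<and> sorted_wrt (>) ys"
proof -
  obtain r where r: "std ys = map r ys" "strict_mono_on (set ys) r"
    by (rule std_conv_map)
  have iff: "sorted_wrt (>) (std ys) \<longleftrightarrow> sorted_wrt (>) ys"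
    unfolding r(1) sorted_wrt_map
    using sorted_wrt_mono_rel[of ys "\<lambda>x y. r x > r y" "(>)"]
      sorted_wrt_mono_rel[of ys "(>)" "\<lambda>x y. r x > r y"] strict_mono_on_less[OF r(2)] by blast
  show ?thesis
  proof
    assume eq: "std ys = decr n"
    have "sorted_wrt (>) (decr n)"
      using sorted_wrt_upt[of 1 "n+1"] by (simp add: decr_def sorted_wrt_rev)
    then show "length ys = n \<and> sorted_wrt (>) ys"
      using iff eq length_std[of ys] by simp
  next
    assume *: "length ys = n \<and> sorted_wrt (>) ys"
    then have "sorted_wrt (<) (rev (std ys))"
      using iff by (simp add: sorted_wrt_rev)
    moreover have "set (std ys) = {1..n}"
      using std_in_Sym[OF assms] * unfolding Sym_iff by blast
    then have "set (rev (std ys)) = set [1..<n+1]"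
      by (simp only: set_rev set_upt Suc_eq_plus1[symmetric] atLeastLessThanSuc_atLeastAtMost)
    ultimately have "rev (std ys) = [1..<n+1]"
      by (metis strict_sorted_equal sorted_wrt_upt)
    then show "std ys = decr n"
      by (simp add: decr_def rev_swap)
  qed
qed

lemma Av_m_decr: "Av_m m (decr n) = {\<sigma> \<in> Sym m. dec_free n \<sigma>}"
proof -
  have "avoids \<sigma> (decr n) \<longleftrightarrow> dec_free n \<sigma>" if "\<sigma> \<in> Sym m" for \<sigma>
  proof -
    have d: "distinct \<sigma>" using that by (simp add: Sym_iff)
    have "(\<exists>I. I \<subseteq> {0..<length \<sigma>} \<and> card I = length (decr n) \<and> pat I \<sigma> = decr n) \<longleftrightarrow>
        (\<exists>I. length (nths \<sigma> I) = n \<and> sorted_wrt (>) (nths \<sigma> I))" (is "?l \<longleftrightarrow> ?r")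
    proof
      assume ?l
      then show ?r using d by (auto simp: pat_def std_eq_decr_iff)
    next
      assume ?r
      then obtain I where I: "length (nths \<sigma> I) = n" "sorted_wrt (>) (nths \<sigma> I)" by blast
      \<comment> \<open>\<open>I\<close> may contain positions beyond the end of
        \<open>\<sigma>\<close>; trimming them makes the cardinality equal to \<open>n\<close>
        without changing the selected entries.\<close>
      let ?I = "{i. i < length \<sigma> \<and> i \<in> I}"
      have "nths \<sigma> ?I = nths \<sigma> I"
        unfolding nths_def by (intro arg_cong[where f = "map fst"] filter_cong)
          (auto dest: set_zip_rightD)
      moreover have "card ?I = n" using I(1) by (simp add: length_nths)
      ultimately show ?l
        using d I by (intro exI[of _ ?I]) (auto simp: pat_def std_eq_decr_iff)
    qed
    then show ?thesis by (auto simp: avoids_def dec_free_def subseq_conv_nths)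
  qed
  then show ?thesis by (auto simp: Av_m_def)
qed

lemma std_in_Av_m:
  "distinct xs \<Longrightarrow> dec_free n xs \<Longrightarrow> length xs = m \<Longrightarrow> std xs \<in> Av_m m (decr n)"
  using std_in_Sym by (auto simp: Av_m_decr dec_free_std)

section \<open>Window counts\<close>

definition win :: "nat \<Rightarrow> nat list \<Rightarrow> nat \<Rightarrow> nat list" where
  "win k xs i = std (take k (drop i xs))"

text \<open>The edge counts of the walk traced by \<open>xs\<close>, before normalisation. Truncated
  subtraction makes the range empty when \<open>xs\<close> has fewer than \<open>k\<close>
  entries.\<close>

definition wcount :: "nat \<Rightarrow> nat list \<Rightarrow> nat list \<Rightarrow> real" where
  "wcount k xs = (\<lambda>\<pi>. \<Sum>i<Suc (length xs) - k. of_bool (win k xs i = \<pi>))"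

lemma win_std: "win k (std xs) i = win k xs i"
  by (metis win_def std_take_std std_drop_std)

lemma wcount_std: "wcount k (std xs) = wcount k xs"
  by (simp add: wcount_def win_std)

lemma wcount_length: "xs \<in> Sym k \<Longrightarrow> wcount k xs = (\<lambda>\<pi>. of_bool (\<pi> = xs))"
  by (auto simp: wcount_def win_def std_Sym length_Sym fun_eq_iff)

text \<open>A window of length \<open>j + 1\<close> starting in \<open>xs\<close> ends before
  \<open>zs\<close>, and any other lies in \<open>ys @ zs\<close>. None is counted twice, since
  \<open>ys\<close> is one entry too short to contain a window.\<close>

lemma wcount_append_overlap:
  assumes "length ys = j"
  shows "wcount (Suc j) (xs @ ys @ zs) = wcount (Suc j) (xs @ ys) + wcount (Suc j) (ys @ zs)"
proof
  fix \<pi>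
  have split: "(\<Sum>i<a + b. f i) = (\<Sum>i<a. f i) + (\<Sum>i<b. f (a + i))" for a b and f :: "nat \<Rightarrow> real"
    by (induction b) (auto simp: add.assoc)
  have 1: "win (Suc j) (xs @ ys @ zs) i = win (Suc j) (xs @ ys) i" if "i < length xs" for i
    using that assms by (simp add: win_def)
  show "wcount (Suc j) (xs @ ys @ zs) \<pi> = (wcount (Suc j) (xs @ ys) + wcount (Suc j) (ys @ zs)) \<pi>"
    using assms by (simp add: wcount_def split 1) (simp add: win_def)
qed

lemma wcount_append_separated:
  assumes "distinct xs" "\<forall>x\<in>set xs. \<forall>y\<in>set ys. x < y"
  shows "wcount k (xs @ ys) = wcount k (dirsum (std xs) (std ys))"
  by (metis assms std_append wcount_std)

lemma std_shift: "std (map (\<lambda>y. y + c) ys) = std ys"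
  by (rule std_map) (auto simp: strict_mono_on_def)

text \<open>Cut after the first \<open>j\<close> entries of the second summand: the left piece sees
  them only through their pattern.\<close>

lemma wcount_dirsum:
  assumes "xs \<in> Sym a" "ys \<in> Sym b" "j \<le> b"
  shows "wcount (Suc j) (dirsum xs ys) = wcount (Suc j) (dirsum xs (std (take j ys))) + wcount (Suc j) ys"
proof -
  let ?ys = "map (\<lambda>y. y + length xs) ys"
  have len: "length ys = b" "length xs = a" using assms length_Sym by auto
  have "wcount (Suc j) (dirsum xs ys) = wcount (Suc j) (xs @ take j ?ys @ drop j ?ys)"
    by (simp add: dirsum_def)
  also have "\<dots> = wcount (Suc j) (xs @ take j ?ys) + wcount (Suc j) (take j ?ys @ drop j ?ys)"
    using assms(3) len by (intro wcount_append_overlap) simp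
  also have "wcount (Suc j) (take j ?ys @ drop j ?ys) = wcount (Suc j) ys"
    using wcount_std[of "Suc j" ?ys] wcount_std[of "Suc j" ys]
    by (simp add: std_shift)
  also have "wcount (Suc j) (xs @ take j ?ys) = wcount (Suc j) (dirsum (std xs) (std (take j ?ys)))"
    using assms len by (intro wcount_append_separated) (auto simp: Sym_iff dest!: in_set_takeD)
  also have "\<dots> = wcount (Suc j) (dirsum xs (std (take j ys)))"
    by (simp add: take_map std_shift std_Sym[OF assms(1)])
  finally show ?thesis .
qed

lemma wcount_dirsum_first:
  assumes "\<pi> \<in> Sym (Suc j)" "ys \<in> Sym b"
  shows "wcount (Suc j) (dirsum \<pi> ys) = (\<lambda>\<tau>. of_bool (\<tau> = \<pi>)) + wcount (Suc j) (dirsum (std (tl \<pi>)) ys)"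
proof -
  let ?ys = "map (\<lambda>y. y + length \<pi>) ys"
  have len: "length \<pi> = Suc j" using assms length_Sym by auto
  have "\<pi> = [hd \<pi>] @ tl \<pi>" using len by (cases \<pi>) auto
  then have "wcount (Suc j) (dirsum \<pi> ys) = wcount (Suc j) ([hd \<pi>] @ tl \<pi> @ ?ys)"
    by (metis dirsum_def append_assoc)
  also have "\<dots> = wcount (Suc j) ([hd \<pi>] @ tl \<pi>) + wcount (Suc j) (tl \<pi> @ ?ys)"
    using len by (intro wcount_append_overlap) simp
  also have "wcount (Suc j) ([hd \<pi>] @ tl \<pi>) = (\<lambda>\<tau>. of_bool (\<tau> = \<pi>))"
    using \<open>\<pi> = [hd \<pi>] @ tl \<pi>\<close> wcount_length[OF assms(1)] by simp
  \<comment> \<open>\<open>?ys\<close> is shifted by \<open>j + 1\<close> although only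
    \<open>j\<close> entries precede it now; it still lies above \<open>tl \<pi>\<close>, and only
    this relative order matters.\<close>
  also have "wcount (Suc j) (tl \<pi> @ ?ys) = wcount (Suc j) (dirsum (std (tl \<pi>)) (std ?ys))"
    using assms len set_drop_subset[of 1 \<pi>] by (intro wcount_append_separated)
      (auto simp: Sym_iff distinct_tl drop_Suc)
  also have "std ?ys = ys" by (simp add: std_shift std_Sym[OF assms(2)])
  finally show ?thesis .
qed

lemma nths_atLeastLessThan: "nths xs {i..<i + k} = take k (drop i xs)"
proof -
  have "(+) i ` {..<k} = {i..<i + k}"
    by (simp add: lessThan_atLeast0 add.commute)
  then show ?thesis
    using nths_drop[of i xs "{..<k}"] by simp
qed

lemma cocc_conv_wcount:
  assumes "\<pi> \<in> Sym k"
  shows "cocc \<pi> \<sigma> = wcount k \<sigma> \<pi> / real (length \<sigma>)"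
proof -
  have "{i. i + k \<le> length \<sigma> \<and> win k \<sigma> i = \<pi>} = {..<Suc (length \<sigma>) - k} \<inter> {i. win k \<sigma> i = \<pi>}"
    by auto
  then show ?thesis
    using length_Sym[OF assms]
    by (simp add: cocc_def wcount_def sum_of_bool_eq pat_def nths_atLeastLessThan win_def)
qed

lemma win_in_Av_m:
  assumes "distinct xs" "dec_free n xs" "i + k \<le> length xs"
  shows "win k xs i \<in> Av_m k (decr n)"
proof -
  have "subseq (take k (drop i xs)) xs"
    by (metis nths_atLeastLessThan subseq_conv_nths)
  then show ?thesis
    unfolding win_def using assms dec_free_subseq by (intro std_in_Av_m) auto
qed

lemma wcount_outside:
  assumes "distinct xs" "dec_free n xs" "\<pi> \<notin> Av_m k (decr n)"
  shows "wcount k xs \<pi> = 0"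
  unfolding wcount_def using win_in_Av_m[OF assms(1,2)] assms(3)
  by (intro sum.neutral) (auto simp: Suc_le_eq less_diff_conv)

lemma wcount_nonneg: "0 \<le> wcount k xs \<pi>"
  unfolding wcount_def by (intro sum_nonneg) auto

lemma wcount_le: "wcount k xs \<pi> \<le> real (Suc (length xs) - k)"
  unfolding wcount_def by (rule order_trans[OF sum_mono[where g = "\<lambda>_. 1"]]) auto

lemma finite_Av_m [simp]: "finite (Av_m m \<pi>)"
  by (simp add: Av_m_def)

text \<open>Swapping sums turns a weighted edge count into a sum along the walk; every window of
  \<open>xs\<close> lies in the class, so it matches exactly one edge.\<close>

lemma sum_wcount:
  assumes "distinct xs" "dec_free n xs"
  shows "(\<Sum>\<pi>\<in>Av_m (Suc j) (decr n). wcount (Suc j) xs \<pi> * g \<pi>)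
    = (\<Sum>i<length xs - j. g (win (Suc j) xs i))"
proof -
  let ?E = "Av_m (Suc j) (decr n)"
  have "(\<Sum>\<pi>\<in>?E. wcount (Suc j) xs \<pi> * g \<pi>)
      = (\<Sum>i<length xs - j. \<Sum>\<pi>\<in>?E. of_bool (win (Suc j) xs i = \<pi>) * g \<pi>)"
    unfolding wcount_def by (subst sum.swap) (simp add: sum_distrib_right)
  also have "\<dots> = (\<Sum>i<length xs - j. g (win (Suc j) xs i))"
  proof (rule sum.cong[OF refl])
    fix i assume "i \<in> {..<length xs - j}"
    then have "win (Suc j) xs i \<in> ?E"
      by (intro win_in_Av_m assms) auto
    then show "(\<Sum>\<pi>\<in>?E. of_bool (win (Suc j) xs i = \<pi>) * g \<pi>) = g (win (Suc j) xs i)"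
      by (simp add: of_bool_def if_distrib[of "\<lambda>x. x * _"] cong: if_cong)
  qed
  finally show ?thesis .
qed

section \<open>Flows on the overlap graph\<close>

text \<open>The overlap graph has vertex set \<open>Av\<^sub>j\<close> and edge set \<open>Av\<^sub>j\<^sub>+\<^sub>1\<close>; the edge \<open>\<pi>\<close> runs
  from the pattern of its first \<open>j\<close> entries to the pattern of its last \<open>j\<close> entries.\<close>

definition net_flow :: "nat list set \<Rightarrow> nat \<Rightarrow> (nat list \<Rightarrow> real) \<Rightarrow> nat list \<Rightarrow> real" where
  "net_flow E j x \<rho> = (\<Sum>\<pi>\<in>E. x \<pi> * (of_bool (std (take j \<pi>) = \<rho>) - of_bool (std (tl \<pi>) = \<rho>)))"

lemma win_begin: "std (take j (win (Suc j) xs i)) = win j xs i"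
  by (simp add: win_def std_take_std min_def)

lemma win_end: "std (tl (win (Suc j) xs i)) = win j xs (Suc i)"
proof -
  have "std (tl (win (Suc j) xs i)) = std (drop 1 (take (Suc j) (drop i xs)))"
    using std_drop_std[of 1 "take (Suc j) (drop i xs)"] by (simp add: win_def drop_Suc)
  also have "drop 1 (take (Suc j) (drop i xs)) = take j (drop (Suc i) xs)"
    by (simp add: drop_take)
  finally show ?thesis by (simp add: win_def)
qed

text \<open>Each edge of the walk ends where the next begins, so the sum telescopes to the two end
  vertices.\<close>

lemma net_flow_wcount:
  assumes "distinct xs" "dec_free n xs"
  shows "net_flow (Av_m (Suc j) (decr n)) j (wcount (Suc j) xs) \<rho>
    = of_bool (win j xs 0 = \<rho>) - of_bool (win j xs (length xs - j) = \<rho>)"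
  unfolding net_flow_def
  by (subst sum_wcount[OF assms])
    (simp add: win_begin win_end sum_lessThan_telescope'[of "\<lambda>i. of_bool (win j xs i = \<rho>)"])

text \<open>\<open>loop j \<rho>\<close> counts the edges of the closed walk traced by \<open>ident j \<oplus> \<rho> \<oplus> ident j\<close>.\<close>

definition loop :: "nat \<Rightarrow> nat list \<Rightarrow> nat list \<Rightarrow> real" where
  "loop j \<rho> = wcount (Suc j) (dirsum (ident j) (dirsum \<rho> (ident j)))"

lemma take_dirsum: "j \<le> length xs \<Longrightarrow> take j (dirsum xs ys) = take j xs"
  by (simp add: dirsum_def)

text \<open>A permutation of size \<open>j\<close> is itself a full overlap, so the loop splits at
  \<open>\<rho>\<close> into a way out from \<open>ident j\<close> and a way back.\<close>

lemma loop_vertex: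
  assumes "\<rho> \<in> Sym j"
  shows "loop j \<rho> = wcount (Suc j) (dirsum (ident j) \<rho>) + wcount (Suc j) (dirsum \<rho> (ident j))"
  unfolding loop_def
  using wcount_dirsum[OF ident_Sym[of j] dirsum_Sym[OF assms ident_Sym[of j]], of j] assms
  by (simp add: take_dirsum length_Sym std_Sym)

text \<open>Cut the loop at the first \<open>j\<close> entries of \<open>\<pi>\<close>, then peel
  off the edge \<open>\<pi>\<close>. What remains is the way back from
  \<open>std (tl \<pi>)\<close>, which also ends the other loop and cancels.\<close>

lemma loop_edge:
  assumes "\<pi> \<in> Sym (Suc j)"
  shows "loop j \<pi> \<tau> - loop j (std (tl \<pi>)) \<tau> = of_bool (\<tau> = \<pi>)
    + wcount (Suc j) (dirsum (ident j) (std (take j \<pi>))) \<tau>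
    - wcount (Suc j) (dirsum (ident j) (std (tl \<pi>))) \<tau>"
proof -
  have "std (tl \<pi>) \<in> Sym (length (tl \<pi>))"
    using assms by (intro std_in_Sym) (auto simp: Sym_iff distinct_tl)
  then have tl: "std (tl \<pi>) \<in> Sym j" using length_Sym[OF assms] by simp
  have "loop j \<pi> = wcount (Suc j) (dirsum (ident j) (std (take j \<pi>)))
      + wcount (Suc j) (dirsum \<pi> (ident j))"
    unfolding loop_def
    using wcount_dirsum[OF ident_Sym[of j] dirsum_Sym[OF assms ident_Sym[of j]], of j] assms
    by (simp add: take_dirsum length_Sym)
  then show ?thesis
    using wcount_dirsum_first[OF assms ident_Sym[of j]] loop_vertex[OF tl] by simp
qed

section \<open>Feasible vectors\<close>

text \<open>The loop traversed \<open>m\<close> times; the final \<open>ident j\<close> closes the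
  last round.\<close>

fun repeat :: "nat \<Rightarrow> nat list \<Rightarrow> nat \<Rightarrow> nat list" where
  "repeat j \<rho> 0 = ident j"
| "repeat j \<rho> (Suc m) = dirsum (dirsum (ident j) \<rho>) (repeat j \<rho> m)"

lemma repeat_Sym: "\<rho> \<in> Sym b \<Longrightarrow> repeat j \<rho> m \<in> Sym (m * (j + b) + j)"
proof (induction m)
  case (Suc m)
  show ?case
    using dirsum_Sym[OF dirsum_Sym[OF ident_Sym[of j] Suc.prems] Suc.IH[OF Suc.prems]]
    by (simp add: add.assoc)
qed (simp add: ident_Sym)

lemma dec_free_repeat:
  assumes "n \<ge> 2" "\<rho> \<in> Sym b" "dec_free n \<rho>"
  shows "dec_free n (repeat j \<rho> m)"
proof (induction m)
  case (Suc m)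
  then show ?case
    using dec_free_dirsum[OF dec_free_ident[OF assms(1)] assms(3) ident_Sym[of j] assms(2)]
      dirsum_Sym[OF ident_Sym[of j] assms(2)] repeat_Sym[OF assms(2)]
    by (auto intro: dec_free_dirsum)
qed (simp add: dec_free_ident assms)

lemma take_repeat: "take j (repeat j \<rho> m) = ident j"
  by (cases m) (simp_all add: take_dirsum)

lemma wcount_repeat:
  assumes "\<rho> \<in> Sym b"
  shows "wcount (Suc j) (repeat j \<rho> m) \<pi> = real m * loop j \<rho> \<pi>"
proof (induction m)
  case 0
  show ?case by (simp add: wcount_def)
next
  case (Suc m)
  have "wcount (Suc j) (repeat j \<rho> (Suc m)) = loop j \<rho> + wcount (Suc j) (repeat j \<rho> m)"
    using wcount_dirsum[OF dirsum_Sym[OF ident_Sym[of j] assms] repeat_Sym[OF assms, of j m], of j]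
    by (simp add: take_repeat std_Sym[OF ident_Sym] dirsum_assoc loop_def)
  then show ?case using Suc.IH by (simp add: algebra_simps)
qed

text \<open>With \<open>m + 1\<close> rounds, counts grow as \<open>m + 1\<close> times the loop and
  lengths as \<open>m + 1\<close> times \<open>j + b\<close>, up to the additive constant
  \<open>j\<close>.\<close>

lemma loop_feasible:
  assumes "n \<ge> 2" "\<rho> \<in> Av_m b (decr n)" "j + b \<ge> 1"
  shows "(\<lambda>\<pi>. loop j \<rho> \<pi> / real (j + b)) \<in> feasible_region (Av (decr n)) (Suc j)"
proof -
  have \<rho>: "\<rho> \<in> Sym b" "dec_free n \<rho>" using assms(2) by (auto simp: Av_m_decr)
  \<comment> \<open>\<open>Suc m\<close> keeps the permutation nonempty even for
    \<open>j = 0\<close>, and makes \<open>\<sigma> 0\<close> the loop itself.\<close>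
  define \<sigma> where "\<sigma> m = repeat j \<rho> (Suc m)" for m
  have \<sigma>_Sym: "\<sigma> m \<in> Sym (Suc m * (j + b) + j)" for m
    unfolding \<sigma>_def by (rule repeat_Sym[OF \<rho>(1)])
  have len: "length (\<sigma> m) = Suc m * (j + b) + j" for m
    by (rule length_Sym[OF \<sigma>_Sym])
  have free: "dec_free n (\<sigma> m)" for m
    unfolding \<sigma>_def by (rule dec_free_repeat[OF assms(1) \<rho>])
  have sub: "Av_m (Suc j) (decr n) \<subseteq> Sym (Suc j)" by (auto simp: Av_m_def)
  have loop: "loop j \<rho> \<pi> = wcount (Suc j) (\<sigma> 0) \<pi>" for \<pi>
    using wcount_repeat[OF \<rho>(1), of j 1 \<pi>] by (simp add: \<sigma>_def)
  have "loop j \<rho> \<pi> = 0" if "\<pi> \<notin> Sym (Suc j)" for \<pi>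
    unfolding loop using that sub \<sigma>_Sym[of 0] free[of 0]
    by (intro wcount_outside[of _ n]) (auto simp: Sym_iff)
  \<comment> \<open>\<open>\<sigma> 0\<close> has length \<open>2 * j + b\<close>, hence exactly
    \<open>j + b\<close> windows.\<close>
  moreover have "loop j \<rho> \<pi> / real (j + b) \<in> {0..1}" for \<pi>
    using wcount_nonneg[of "Suc j" "\<sigma> 0" \<pi>] wcount_le[of "Suc j" "\<sigma> 0" \<pi>] assms(3) len[of 0]
    by (simp add: loop divide_le_eq)
  moreover have "\<sigma> m \<in> Av (decr n)" for m
    unfolding Av_def using \<sigma>_Sym[of m] free[of m] assms(3)
    by (intro UN_I[of "Suc m * (j + b) + j"]) (auto simp: Av_m_decr)
  moreover have "filterlim (\<lambda>m. length (\<sigma> m)) at_top sequentially"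
  proof (rule filterlim_at_top_mono[OF filterlim_ident])
    have "m \<le> Suc m * (j + b)" for m
      using assms(3) by (metis Suc_leD le_refl mult_le_mono mult.right_neutral)
    then show "\<forall>\<^sub>F m in sequentially. m \<le> length (\<sigma> m)"
      by (intro always_eventually allI) (metis len trans_le_add1)
  qed
  moreover have "(\<lambda>m. cocc \<pi> (\<sigma> m)) \<longlonglongrightarrow> loop j \<rho> \<pi> / real (j + b)" if "\<pi> \<in> Sym (Suc j)" for \<pi>
  proof -
    have "(\<lambda>m. loop j \<rho> \<pi> / (real (j + b) + real j / real (Suc m)))
        \<longlonglongrightarrow> loop j \<rho> \<pi> / (real (j + b) + 0)"
      using assms(3) by (intro tendsto_intros LIMSEQ_Suc[OF lim_const_over_n]) auto
    moreover have "cocc \<pi> (\<sigma> m) = loop j \<rho> \<pi> / (real (j + b) + real j / real (Suc m))" for m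
    proof -
      have "cocc \<pi> (\<sigma> m) = real (Suc m) * loop j \<rho> \<pi> / (real (Suc m) * real (j + b) + real j)"
        using wcount_repeat[OF \<rho>(1), of j "Suc m" \<pi>]
        by (simp add: cocc_conv_wcount[OF that] len \<sigma>_def[symmetric] distrib_right del: repeat.simps)
      also have "\<dots> = real (Suc m) * loop j \<rho> \<pi> / (real (Suc m) * (real (j + b) + real j / real (Suc m)))"
        by (simp add: distrib_left)
      also have "\<dots> = loop j \<rho> \<pi> / (real (j + b) + real j / real (Suc m))"
        by (rule mult_divide_mult_cancel_left) simp
      finally show ?thesis .
    qed
    ultimately show ?thesis by simp
  qed
  ultimately show ?thesis
    unfolding feasible_region_def mem_Collect_eq by (intro conjI exI[of _ \<sigma>]) auto
qed

text \<open>Along the approximating sequence the net flow is at most 1 in absolute value and the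
  mass is the length minus \<open>j\<close>; after division by the length these errors
  vanish.\<close>

lemma feasible_flow:
  assumes "v \<in> feasible_region (Av (decr n)) (Suc j)"
  defines "E \<equiv> Av_m (Suc j) (decr n)"
  shows "\<forall>\<pi>. \<pi> \<notin> E \<longrightarrow> v \<pi> = 0" and "net_flow E j v \<rho> = 0" and "(\<Sum>\<pi>\<in>E. v \<pi>) = 1"
proof -
  obtain \<sigma> :: "nat \<Rightarrow> nat list" where v: "\<forall>\<pi>. \<pi> \<notin> Sym (Suc j) \<longrightarrow> v \<pi> = 0"
    and \<sigma>: "\<And>m. \<sigma> m \<in> Av (decr n)" "filterlim (\<lambda>m. length (\<sigma> m)) at_top sequentially"
    and lim: "\<And>\<pi>. \<pi> \<in> Sym (Suc j) \<Longrightarrow> (\<lambda>m. cocc \<pi> (\<sigma> m)) \<longlonglongrightarrow> v \<pi>"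
    using assms(1) unfolding feasible_region_def by blast
  have d: "distinct (\<sigma> m)" and free: "dec_free n (\<sigma> m)" for m
    using \<sigma>(1)[of m] by (auto simp: Av_def Av_m_decr Sym_iff)
  have E: "E \<subseteq> Sym (Suc j)" "finite E" by (auto simp: E_def Av_m_def)
  have inv: "(\<lambda>m. c / real (length (\<sigma> m))) \<longlonglongrightarrow> 0" for c
    using filterlim_compose[OF filterlim_real_sequentially \<sigma>(2)]
    by (rule real_tendsto_divide_at_top[OF tendsto_const])
  show "\<forall>\<pi>. \<pi> \<notin> E \<longrightarrow> v \<pi> = 0"
  proof (intro allI impI)
    fix \<pi> assume "\<pi> \<notin> E"
    show "v \<pi> = 0"
    proof (cases "\<pi> \<in> Sym (Suc j)")
      case True
      then have "cocc \<pi> (\<sigma> m) = 0" for m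
        using wcount_outside[OF d free] \<open>\<pi> \<notin> E\<close> by (simp add: cocc_conv_wcount E_def)
      then show ?thesis using lim[OF True] by (simp add: LIMSEQ_const_iff)
    qed (use v in auto)
  qed
  \<comment> \<open>Any linear functional passes to the limit; it is applied to the incidence
    weights and to the constant 1.\<close>
  have lim': "(\<lambda>m. (\<Sum>\<pi>\<in>E. wcount (Suc j) (\<sigma> m) \<pi> * g \<pi>) / real (length (\<sigma> m)))
      \<longlonglongrightarrow> (\<Sum>\<pi>\<in>E. v \<pi> * g \<pi>)" for g
  proof -
    have "(\<lambda>m. \<Sum>\<pi>\<in>E. cocc \<pi> (\<sigma> m) * g \<pi>) \<longlonglongrightarrow> (\<Sum>\<pi>\<in>E. v \<pi> * g \<pi>)"
      using E by (intro tendsto_intros lim) auto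
    moreover have "(\<Sum>\<pi>\<in>E. cocc \<pi> (\<sigma> m) * g \<pi>)
        = (\<Sum>\<pi>\<in>E. wcount (Suc j) (\<sigma> m) \<pi> * g \<pi>) / real (length (\<sigma> m))" for m
      unfolding sum_divide_distrib
      by (rule sum.cong) (use E in \<open>auto simp: cocc_conv_wcount[of _ "Suc j"]\<close>)
    ultimately show ?thesis by simp
  qed
  have "(\<lambda>m. net_flow E j (wcount (Suc j) (\<sigma> m)) \<rho> / real (length (\<sigma> m))) \<longlonglongrightarrow> 0"
  proof (rule Lim_null_comparison[OF _ inv[of 1]], intro always_eventually allI)
    fix m
    show "norm (net_flow E j (wcount (Suc j) (\<sigma> m)) \<rho> / real (length (\<sigma> m))) \<le> 1 / real (length (\<sigma> m))"
      unfolding E_def net_flow_wcount[OF d free] by (simp add: of_bool_def)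
  qed
  moreover have "(\<lambda>m. net_flow E j (wcount (Suc j) (\<sigma> m)) \<rho> / real (length (\<sigma> m)))
      \<longlonglongrightarrow> net_flow E j v \<rho>"
    unfolding net_flow_def by (rule lim')
  ultimately show "net_flow E j v \<rho> = 0"
    using LIMSEQ_unique by blast
  have "(\<lambda>m. real (length (\<sigma> m) - j) / real (length (\<sigma> m))) \<longlonglongrightarrow> (\<Sum>\<pi>\<in>E. v \<pi>)"
    using lim'[of "\<lambda>_. 1"] sum_wcount[OF d free, where j = j and g = "\<lambda>_. 1"] by (simp add: E_def)
  moreover have "(\<lambda>m. real (length (\<sigma> m) - j) / real (length (\<sigma> m))) \<longlonglongrightarrow> 1"
  proof (rule Lim_transform_eventually)
    show "(\<lambda>m. 1 - real j / real (length (\<sigma> m))) \<longlonglongrightarrow> 1"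
      using tendsto_diff[OF tendsto_const inv[of "real j"], of 1] by simp
    \<comment> \<open>From here on the truncated subtraction is a true one and the length is
      nonzero.\<close>
    have "\<forall>\<^sub>F m in sequentially. Suc j \<le> length (\<sigma> m)"
      using \<sigma>(2) by (simp add: filterlim_at_top)
    then show "\<forall>\<^sub>F m in sequentially. 1 - real j / real (length (\<sigma> m))
        = real (length (\<sigma> m) - j) / real (length (\<sigma> m))"
      by eventually_elim (auto simp: diff_divide_distrib of_nat_diff)
  qed
  ultimately show "(\<Sum>\<pi>\<in>E. v \<pi>) = 1"
    using LIMSEQ_unique by blast
qed

section \<open>Dimension of the space of flows\<close>

text \<open>The scalar multiplication is the one in \<open>fun_aff_dim\<close>, so both notions of
  \<open>dim\<close> agree.\<close>

interpretation fun_space: vector_space "\<lambda>c (f :: 'a \<Rightarrow> real) x. c * f x"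
  by unfold_locales (auto simp: fun_eq_iff algebra_simps)

text \<open>\<open>\<phi> t\<close> vanishes on \<open>B\<close> and on the other \<open>r s\<close>
  but not on \<open>r t\<close>, so each new vector leaves the span of the previous ones.\<close>

lemma independent_Un_dual:
  fixes \<phi> :: "'i \<Rightarrow> ('a \<Rightarrow> real) \<Rightarrow> real"
  assumes "finite S" "finite B" "fun_space.independent B"
    and add: "\<And>s x y. \<phi> s (x + y) = \<phi> s x + \<phi> s y"
    and scale: "\<And>s c x. \<phi> s (\<lambda>a. c * x a) = c * \<phi> s x"
    and B: "\<And>s b. s \<in> S \<Longrightarrow> b \<in> B \<Longrightarrow> \<phi> s b = 0"
    and r: "\<And>s t. s \<in> S \<Longrightarrow> t \<in> S \<Longrightarrow> \<phi> s (r t) = of_bool (s = t)"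
  shows "fun_space.independent (B \<union> r ` S) \<and> card (B \<union> r ` S) = card B + card S"
  using assms(1) B r
proof (induction S)
  case (insert t S)
  have "\<phi> t 0 = 0" using scale[of t 0 0] by (simp add: zero_fun_def)
  then have "fun_space.subspace {x. \<phi> t x = 0}"
    by (auto simp: fun_space.subspace_def add scale)
  moreover have "B \<union> r ` S \<subseteq> {x. \<phi> t x = 0}"
    using insert.prems insert.hyps by auto
  ultimately have "fun_space.span (B \<union> r ` S) \<subseteq> {x. \<phi> t x = 0}"
    by (intro fun_space.span_minimal)
  moreover have "\<phi> t (r t) = 1" using insert.prems by simp
  ultimately have nin: "r t \<notin> fun_space.span (B \<union> r ` S)" by auto
  then have "r t \<notin> B \<union> r ` S" using fun_space.span_superset[of "B \<union> r ` S"] by auto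
  moreover have "fun_space.independent (B \<union> r ` S) \<and> card (B \<union> r ` S) = card B + card S"
    using insert.prems by (intro insert.IH) auto
  moreover have "finite (B \<union> r ` S)" using insert.hyps assms(2) by simp
  ultimately show ?case
    using insert.hyps fun_space.independent_insertI[OF nin] by simp
qed (use assms in simp)

lemma sum_fun_apply: "(\<Sum>i\<in>I. f i) x = (\<Sum>i\<in>I. f i x)" for f :: "'i \<Rightarrow> 'a \<Rightarrow> real"
  by (induction I rule: infinite_finite_induct) auto

text \<open>Rank-nullity, with surjectivity witnessed by the right inverse \<open>r\<close>.\<close>

lemma dim_common_kernel:
  fixes \<phi> :: "'i \<Rightarrow> ('a \<Rightarrow> real) \<Rightarrow> real"
  assumes "finite S" "finite E"
    and add: "\<And>s x y. \<phi> s (x + y) = \<phi> s x + \<phi> s y"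
    and scale: "\<And>s c x. \<phi> s (\<lambda>a. c * x a) = c * \<phi> s x"
    and supp: "\<And>s a. s \<in> S \<Longrightarrow> a \<notin> E \<Longrightarrow> r s a = 0"
    and r: "\<And>s t. s \<in> S \<Longrightarrow> t \<in> S \<Longrightarrow> \<phi> s (r t) = of_bool (s = t)"
  shows "fun_space.dim {x. (\<forall>a. a \<notin> E \<longrightarrow> x a = 0) \<and> (\<forall>s\<in>S. \<phi> s x = 0)} + card S = card E"
proof -
  define X :: "('a \<Rightarrow> real) set" where "X = {x. \<forall>a. a \<notin> E \<longrightarrow> x a = 0}"
  define K where "K = {x \<in> X. \<forall>s\<in>S. \<phi> s x = 0}"
  define e :: "'a \<Rightarrow> 'a \<Rightarrow> real" where "e b a = of_bool (a = b)" for a b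
  \<comment> \<open>The unit vectors are dual to the coordinate functionals.\<close>
  have e: "fun_space.independent (e ` E) \<and> card (e ` E) = card E"
    using independent_Un_dual[of E "{}" "\<lambda>a x. x a" e] assms(2)
    by (simp add: e_def fun_space.independent_empty)
  have X_span: "X \<subseteq> fun_space.span (e ` E)"
  proof
    fix x assume x: "x \<in> X"
    have "x = (\<Sum>b\<in>E. (\<lambda>a. x b * e b a))"
    proof
      fix a
      show "x a = (\<Sum>b\<in>E. (\<lambda>a. x b * e b a)) a"
        using x assms(2)
        by (cases "a \<in> E")
          (auto simp: sum_fun_apply e_def X_def of_bool_def if_distrib cong: if_cong)
    qed
    also have "\<dots> \<in> fun_space.span (e ` E)"
      by (intro fun_space.span_sum fun_space.span_scale fun_space.span_base) auto
    finally show "x \<in> fun_space.span (e ` E)" .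
  qed
  have "e ` E \<subseteq> X" by (auto simp: e_def X_def)
  then have dim_X: "fun_space.dim X = card E"
    using X_span e by (intro fun_space.dim_unique) auto
  obtain B where B: "B \<subseteq> K" "fun_space.independent B" "K \<subseteq> fun_space.span B"
    "card B = fun_space.dim K"
    by (rule fun_space.basis_exists)
  have finB: "finite B"
    using fun_space.independent_span_bound[of "e ` E" B] B X_span assms(2)
    by (auto simp: K_def)
  have ind: "fun_space.independent (B \<union> r ` S) \<and> card (B \<union> r ` S) = card B + card S"
    using B(1) by (intro independent_Un_dual[where \<phi> = \<phi>] assms finB B) (auto simp: K_def)
  have sum: "\<phi> s (\<Sum>i\<in>I. f i) = (\<Sum>i\<in>I. \<phi> s (f i))" for s I and f :: "'i \<Rightarrow> 'a \<Rightarrow> real"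
  proof (induction I rule: infinite_finite_induct)
    case empty
    show ?case using scale[of s 0 0] by (simp add: zero_fun_def)
  next
    case (infinite I)
    then show ?case using scale[of s 0 0] by (simp add: zero_fun_def)
  qed (simp only: sum.insert add not_False_eq_True)
  have "X \<subseteq> fun_space.span (B \<union> r ` S)"
  proof
    fix x assume x: "x \<in> X"
    \<comment> \<open>\<open>y\<close> takes the same values as \<open>x\<close> under all
      \<open>\<phi> s\<close>, so \<open>x - y\<close> lies in the kernel.\<close>
    define y where "y = (\<Sum>s\<in>S. (\<lambda>a. \<phi> s x * r s a))"
    have y: "y \<in> fun_space.span (B \<union> r ` S)"
      unfolding y_def by (intro fun_space.span_sum fun_space.span_scale fun_space.span_base) auto
    have "\<phi> s (x - y) = 0" if "s \<in> S" for s
    proof -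
      have "\<phi> s y = (\<Sum>t\<in>S. \<phi> t x * of_bool (s = t))"
        unfolding y_def sum using that by (intro sum.cong) (auto simp: scale r)
      also have "\<dots> = \<phi> s x"
        using that assms(1) by (simp add: of_bool_def if_distrib cong: if_cong)
      finally show ?thesis using add[of s "x - y" y] by simp
    qed
    moreover have "x - y \<in> X"
      using x supp by (auto simp: X_def y_def sum_fun_apply)
    ultimately have "x - y \<in> fun_space.span (B \<union> r ` S)"
      using B(3) fun_space.span_mono[of B "B \<union> r ` S"] by (auto simp: K_def)
    then show "x \<in> fun_space.span (B \<union> r ` S)"
      using fun_space.span_add[OF _ y] by fastforce
  qed
  moreover have "B \<union> r ` S \<subseteq> X" using B(1) supp by (auto simp: K_def X_def)
  ultimately have "fun_space.dim X = card B + card S"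
    using ind by (intro fun_space.dim_unique) auto
  then have "fun_space.dim K + card S = card E" using dim_X B(4) by simp
  then show ?thesis by (simp add: K_def X_def conj_commute)
qed

section \<open>Dimension of the closed flows\<close>

lemma win_ident: "i + j \<le> m \<Longrightarrow> win j (ident m) i = ident j"
proof -
  assume "i + j \<le> m"
  then have "take j (drop i (ident m)) = map (\<lambda>y. y + i) (ident j)"
    by (simp add: ident_def list_eq_iff_nth_eq del: upt_Suc)
  then show ?thesis by (simp add: win_def std_shift std_Sym[OF ident_Sym])
qed

text \<open>Vanishing of \<open>closed_functional E j \<rho>\<close> for all vertices \<open>\<rho>\<close> says that \<open>x\<close> is a flow of total
  mass zero, since the net flows sum to zero over the vertices.\<close>

definition closed_functional :: "nat list set \<Rightarrow> nat \<Rightarrow> nat list \<Rightarrow> (nat list \<Rightarrow> real) \<Rightarrow> real" where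
  "closed_functional E j \<rho> x = net_flow E j x \<rho> + of_bool (\<rho> = ident j) * sum x E"

lemma closed_functional_add:
  "closed_functional E j \<rho> (x + y) = closed_functional E j \<rho> x + closed_functional E j \<rho> y"
  by (simp add: closed_functional_def net_flow_def sum.distrib distrib_left distrib_right)

lemma closed_functional_scale:
  "closed_functional E j \<rho> (\<lambda>\<pi>. c * x \<pi>) = c * closed_functional E j \<rho> x"
  by (simp add: closed_functional_def net_flow_def sum_distrib_left[symmetric] mult.assoc distrib_left
      mult.left_commute[of _ c])

lemma sum_wcount_total:
  assumes "distinct xs" "dec_free n xs"
  shows "sum (wcount (Suc j) xs) (Av_m (Suc j) (decr n)) = real (length xs - j)"
  using sum_wcount[OF assms, of j "\<lambda>_. 1"] by simp

lemma closed_functional_wcount: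
  assumes "distinct xs" "dec_free n xs"
  shows "closed_functional (Av_m (Suc j) (decr n)) j \<rho> (wcount (Suc j) xs)
    = of_bool (win j xs 0 = \<rho>) - of_bool (win j xs (length xs - j) = \<rho>)
      + of_bool (\<rho> = ident j) * real (length xs - j)"
  by (simp add: closed_functional_def net_flow_wcount[OF assms] sum_wcount_total[OF assms])

lemma dim_closed_flows:
  fixes n j :: nat
  assumes "n \<ge> 2"
  defines "E \<equiv> Av_m (Suc j) (decr n)" and "V \<equiv> Av_m j (decr n)"
  shows "fun_space.dim {x. (\<forall>\<pi>. \<pi> \<notin> E \<longrightarrow> x \<pi> = 0) \<and> (\<forall>\<rho>\<in>V. closed_functional E j \<rho> x = 0)}
    + card V = card E"
proof -
  \<comment> \<open>\<open>u\<close> is the self-loop at \<open>ident j\<close>, of mass 1, and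
    \<open>w \<tau>\<close> a walk of \<open>j\<close> edges from \<open>ident j\<close> to
    \<open>\<tau>\<close>. The factor \<open>j + 1\<close> in \<open>r\<close> offsets the start
    term 1 and the mass \<open>j\<close> of \<open>w \<tau>\<close>, leaving only the end vertex
    \<open>\<tau>\<close>.\<close>
  define u where "u = wcount (Suc j) (ident (Suc j))"
  define w where "w \<tau> = wcount (Suc j) (dirsum (ident j) \<tau>)" for \<tau>
  define r where "r \<tau> = (\<lambda>\<pi>. real (Suc j) * u \<pi>) + (\<lambda>\<pi>. (-1) * w \<tau> \<pi>)" for \<tau>
  have id: "distinct (ident m)" "dec_free n (ident m)" for m
    using ident_Sym dec_free_ident[OF assms(1)] by (auto simp: Sym_iff)
  have u: "closed_functional E j \<rho> u = of_bool (\<rho> = ident j)" for \<rho>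
    unfolding u_def E_def by (subst closed_functional_wcount[OF id]) (simp add: win_ident)
  have V: "\<tau> \<in> Sym j" "length \<tau> = j" "distinct (dirsum (ident j) \<tau>)" "dec_free n (dirsum (ident j) \<tau>)"
    if "\<tau> \<in> V" for \<tau>
    using that dirsum_Sym[OF ident_Sym, of \<tau> j j] dec_free_dirsum[OF id(2) _ ident_Sym, of \<tau> j j]
      length_Sym[of \<tau> j] by (auto simp: V_def Av_m_decr Sym_iff)
  have w: "closed_functional E j \<rho> (w \<tau>)
      = of_bool (\<rho> = ident j) - of_bool (\<rho> = \<tau>) + of_bool (\<rho> = ident j) * real j"
    if "\<tau> \<in> V" for \<rho> \<tau>
  proof -
    have "win j (dirsum (ident j) \<tau>) 0 = ident j"
      by (simp add: win_def take_dirsum std_Sym[OF ident_Sym])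
    moreover have "win j (dirsum (ident j) \<tau>) j = \<tau>"
      using V[OF that] by (simp add: win_def dirsum_def std_shift std_Sym)
    ultimately show ?thesis
      unfolding w_def E_def using V[OF that]
      by (subst closed_functional_wcount) (auto simp: eq_commute)
  qed
  show ?thesis
  proof (rule dim_common_kernel[where r = r])
    show "r \<tau> \<pi> = 0" if "\<tau> \<in> V" "\<pi> \<notin> E" for \<tau> \<pi>
      using wcount_outside[OF id] wcount_outside[OF V(3,4)[OF that(1)]] that(2)
      by (simp add: r_def u_def w_def E_def)
    show "closed_functional E j \<rho> (r \<tau>) = of_bool (\<rho> = \<tau>)" if "\<rho> \<in> V" "\<tau> \<in> V" for \<rho> \<tau>
      unfolding r_def closed_functional_add closed_functional_scale u w[OF that(2)]
      by (simp add: algebra_simps)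
  qed (auto simp: E_def V_def closed_functional_add closed_functional_scale)
qed

section \<open>Closed flows as combinations of loops\<close>

lemma edge_ends_in_Av_m:
  assumes "\<pi> \<in> Av_m (Suc j) (decr n)"
  shows "std (take j \<pi>) \<in> Av_m j (decr n)" "std (tl \<pi>) \<in> Av_m j (decr n)"
proof -
  have \<pi>: "distinct \<pi>" "dec_free n \<pi>" "length \<pi> = Suc j"
    using assms length_Sym by (auto simp: Av_m_decr Sym_iff)
  then show "std (take j \<pi>) \<in> Av_m j (decr n)" "std (tl \<pi>) \<in> Av_m j (decr n)"
    using win_in_Av_m[of \<pi> n 0 j] win_in_Av_m[of \<pi> n 1 j] by (auto simp: win_def drop_Suc)
qed

text \<open>Summation by parts: a potential \<open>g\<close> on vertices becomes its difference
  along edges. Constant \<open>g\<close> shows that net flows sum to zero.\<close>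

lemma sum_net_flow:
  "(\<Sum>\<rho>\<in>Av_m j (decr n). g \<rho> * net_flow (Av_m (Suc j) (decr n)) j x \<rho>)
    = (\<Sum>\<pi>\<in>Av_m (Suc j) (decr n). x \<pi> * (g (std (take j \<pi>)) - g (std (tl \<pi>))))"
proof -
  let ?V = "Av_m j (decr n)" and ?E = "Av_m (Suc j) (decr n)"
  have one: "(\<Sum>\<rho>\<in>?V. g \<rho> * of_bool (\<tau> = \<rho>)) = g \<tau>" if "\<tau> \<in> ?V" for \<tau>
    using that by (simp add: of_bool_def if_distrib cong: if_cong)
  have "(\<Sum>\<rho>\<in>?V. g \<rho> * net_flow ?E j x \<rho>) = (\<Sum>\<pi>\<in>?E. \<Sum>\<rho>\<in>?V.
      x \<pi> * (g \<rho> * of_bool (std (take j \<pi>) = \<rho>) - g \<rho> * of_bool (std (tl \<pi>) = \<rho>)))"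
    unfolding net_flow_def sum_distrib_left by (subst sum.swap) (simp add: algebra_simps)
  also have "\<dots> = (\<Sum>\<pi>\<in>?E. x \<pi> * (g (std (take j \<pi>)) - g (std (tl \<pi>))))"
    by (intro sum.cong refl)
      (simp only: sum_distrib_left[symmetric] sum_subtractf one edge_ends_in_Av_m)
  finally show ?thesis .
qed

lemma closed_flow_iff:
  fixes n j :: nat
  assumes "n \<ge> 2"
  defines "E \<equiv> Av_m (Suc j) (decr n)" and "V \<equiv> Av_m j (decr n)"
  shows "(\<forall>\<rho>\<in>V. closed_functional E j \<rho> x = 0) \<longleftrightarrow>
    (\<forall>\<rho>\<in>V. net_flow E j x \<rho> = 0) \<and> sum x E = 0"
proof -
  \<comment> \<open>This makes the mass term survive exactly once in the sum over
    \<open>V\<close>.\<close>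
  have "ident j \<in> V"
    using ident_Sym dec_free_ident[OF assms(1)] by (simp add: V_def Av_m_decr)
  then have "(\<Sum>\<rho>\<in>V. closed_functional E j \<rho> x)
      = (\<Sum>\<rho>\<in>V. net_flow E j x \<rho>) + sum x E"
    unfolding closed_functional_def sum.distrib
    by (simp add: V_def of_bool_def if_distrib[of "\<lambda>c. c * _"] cong: if_cong)
  also have "(\<Sum>\<rho>\<in>V. net_flow E j x \<rho>) = 0"
    using sum_net_flow[of "\<lambda>_. 1" j n x] by (simp add: V_def E_def)
  finally have total: "(\<Sum>\<rho>\<in>V. closed_functional E j \<rho> x) = sum x E" by simp
  show ?thesis
  proof (cases "sum x E = 0")
    case True
    then show ?thesis by (simp add: closed_functional_def)
  next
    case False
    then show ?thesis using total by (metis sum.neutral)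
  qed
qed

text \<open>Weight \<open>loop_edge\<close> by \<open>x\<close> and sum: the unit vectors give
  \<open>x\<close>, and the remaining terms are differences of the potential \<open>g\<close>, which
  vanish by \<open>sum_net_flow\<close>.\<close>

lemma closed_flow_eq_sum_loops:
  assumes "\<forall>\<pi>. \<pi> \<notin> Av_m (Suc j) (decr n) \<longrightarrow> x \<pi> = 0"
    and "\<forall>\<rho>\<in>Av_m j (decr n). net_flow (Av_m (Suc j) (decr n)) j x \<rho> = 0"
  shows "x \<tau> = (\<Sum>\<pi>\<in>Av_m (Suc j) (decr n). x \<pi> * (loop j \<pi> \<tau> - loop j (std (tl \<pi>)) \<tau>))"
proof -
  let ?E = "Av_m (Suc j) (decr n)"
  define g where "g \<rho> = wcount (Suc j) (dirsum (ident j) \<rho>) \<tau>" for \<rho>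
  have "(\<Sum>\<pi>\<in>?E. x \<pi> * (loop j \<pi> \<tau> - loop j (std (tl \<pi>)) \<tau>))
      = (\<Sum>\<pi>\<in>?E. x \<pi> * of_bool (\<tau> = \<pi>) + x \<pi> * (g (std (take j \<pi>)) - g (std (tl \<pi>))))"
    by (intro sum.cong refl, subst loop_edge) (auto simp: Av_m_def g_def algebra_simps)
  also have "\<dots> = (\<Sum>\<pi>\<in>?E. x \<pi> * of_bool (\<tau> = \<pi>))"
    using assms(2) unfolding sum.distrib sum_net_flow[symmetric] by simp
  also have "\<dots> = x \<tau>"
    using assms(1) by (cases "\<tau> \<in> ?E") (auto simp: of_bool_def if_distrib cong: if_cong)
  finally show ?thesis by simp
qed

text \<open>Each functional is constant on feasible vectors, which gives one inclusion; the loop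
  expansion, translated by \<open>a\<close>, gives the other.\<close>

lemma span_feasible_differences:
  assumes "n \<ge> 2" and a: "a \<in> feasible_region (Av (decr n)) (Suc j)"
  defines "E \<equiv> Av_m (Suc j) (decr n)" and "V \<equiv> Av_m j (decr n)"
  shows "fun_space.span ((\<lambda>x. x - a) ` feasible_region (Av (decr n)) (Suc j))
    = {x. (\<forall>\<pi>. \<pi> \<notin> E \<longrightarrow> x \<pi> = 0) \<and> (\<forall>\<rho>\<in>V. closed_functional E j \<rho> x = 0)}"
    (is "fun_space.span ((\<lambda>x. x - a) ` ?P) = ?K")
proof
  have "closed_functional E j \<rho> 0 = 0" for \<rho>
    by (simp add: closed_functional_def net_flow_def)
  then have "fun_space.subspace ?K"
    by (auto simp: fun_space.subspace_def closed_functional_add closed_functional_scale)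
  moreover have "x - a \<in> ?K" if "x \<in> ?P" for x
  proof -
    have "closed_functional E j \<rho> x = closed_functional E j \<rho> a" for \<rho>
      using feasible_flow[OF that] feasible_flow[OF a] by (simp add: closed_functional_def E_def)
    then have "closed_functional E j \<rho> (x - a) = 0" for \<rho>
      using closed_functional_add[of E j \<rho> "x - a" a] by simp
    then show ?thesis
      using feasible_flow(1)[OF that] feasible_flow(1)[OF a] by (simp add: E_def)
  qed
  ultimately show "fun_space.span ((\<lambda>x. x - a) ` ?P) \<subseteq> ?K"
    by (intro fun_space.span_minimal) auto
next
  show "?K \<subseteq> fun_space.span ((\<lambda>x. x - a) ` ?P)"
  proof
    fix y assume "y \<in> ?K"
    then have y: "\<forall>\<pi>. \<pi> \<notin> E \<longrightarrow> y \<pi> = 0" "\<forall>\<rho>\<in>V. net_flow E j y \<rho> = 0" "sum y E = 0"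
      using closed_flow_iff[OF assms(1), of j y] by (auto simp: E_def V_def)
    have feas: "\<exists>p\<in>?P. loop j \<rho> = (\<lambda>\<tau>. real (j + b) * p \<tau>)" if "\<rho> \<in> Av_m b (decr n)" for \<rho> b
    proof (cases "j + b \<ge> 1")
      case True
      then show ?thesis
        by (intro bexI[OF _ loop_feasible[OF assms(1) that True]]) auto
    next
      \<comment> \<open>The loop is then the zero vector and the factor is 0, so any feasible vector
        serves.\<close>
      case False
      then have "j = 0" "b = 0" by auto
      then have "loop j \<rho> = (\<lambda>\<tau>. real (j + b) * a \<tau>)"
        using that length_Sym[of \<rho> b] by (simp add: Av_m_def loop_def wcount_def)
      then show ?thesis using a by blast
    qed
    define p where "p \<rho> b = (SOME p. p \<in> ?P \<and> loop j \<rho> = (\<lambda>\<tau>. real (j + b) * p \<tau>))" for \<rho> b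
    have p: "p \<rho> b \<in> ?P" "loop j \<rho> = (\<lambda>\<tau>. real (j + b) * p \<rho> b \<tau>)"
      if "\<rho> \<in> Av_m b (decr n)" for \<rho> b
      using someI_ex[OF feas[OF that, unfolded Bex_def]] unfolding p_def by auto
    note p_edge = p[where b = "Suc j", folded E_def] and p_vertex = p[where b = j, folded V_def]
    have tl: "std (tl \<pi>) \<in> V" if "\<pi> \<in> E" for \<pi>
      using that edge_ends_in_Av_m(2) by (simp add: E_def V_def)
    \<comment> \<open>The coefficients \<open>2 * j + 1\<close> and \<open>2 * j\<close> differ by
      one, so translating by \<open>a\<close> changes each term by exactly
      \<open>y \<pi> * a\<close>; these corrections sum to zero because \<open>y\<close> has total
      mass zero.\<close>
    let ?d = "\<lambda>\<pi>. (\<lambda>\<tau>. real (j + Suc j) * (p \<pi> (Suc j) - a) \<tau>) - (\<lambda>\<tau>. real (j + j) * (p (std (tl \<pi>)) j - a) \<tau>)"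
    have "y = (\<Sum>\<pi>\<in>E. (\<lambda>\<tau>. y \<pi> * ?d \<pi> \<tau>))"
    proof
      fix \<tau>
      have "y \<tau> = (\<Sum>\<pi>\<in>E. y \<pi> * (loop j \<pi> \<tau> - loop j (std (tl \<pi>)) \<tau>))"
        using closed_flow_eq_sum_loops y unfolding E_def V_def by blast
      also have "\<dots> = (\<Sum>\<pi>\<in>E. y \<pi> * ?d \<pi> \<tau> + y \<pi> * a \<tau>)"
      proof (intro sum.cong refl)
        fix \<pi> assume \<pi>: "\<pi> \<in> E"
        show "y \<pi> * (loop j \<pi> \<tau> - loop j (std (tl \<pi>)) \<tau>) = y \<pi> * ?d \<pi> \<tau> + y \<pi> * a \<tau>"
          unfolding fun_cong[OF p_edge(2)[OF \<pi>]] fun_cong[OF p_vertex(2)[OF tl[OF \<pi>]]]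
            minus_apply by (simp add: algebra_simps)
      qed
      also have "\<dots> = (\<Sum>\<pi>\<in>E. y \<pi> * ?d \<pi> \<tau>)"
        unfolding sum.distrib sum_distrib_right[symmetric] y(3) by simp
      finally show "y \<tau> = (\<Sum>\<pi>\<in>E. (\<lambda>\<tau>. y \<pi> * ?d \<pi> \<tau>)) \<tau>"
        by (simp add: sum_fun_apply)
    qed
    also have "\<dots> \<in> fun_space.span ((\<lambda>x. x - a) ` ?P)"
      by (intro fun_space.span_sum fun_space.span_scale fun_space.span_diff fun_space.span_base
          imageI p_edge(1) p_vertex(1) tl)
    finally show "y \<in> fun_space.span ((\<lambda>x. x - a) ` ?P)" .
  qed
qed

theorem mainTheorem8:
  fixes n k :: nat
  assumes "n \<ge> 2" and "k \<ge> 1"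
  shows "fun_aff_dim (feasible_region (Av (decr n)) k)
           = int (card (Av_m k (decr n))) - int (card (Av_m (k - 1) (decr n)))"
proof -
  obtain j where k: "k = Suc j" using assms(2) by (cases k) auto
  let ?P = "feasible_region (Av (decr n)) k"
  define a where "a = (SOME a. a \<in> ?P)"
  have "ident k \<in> Av_m k (decr n)"
    using ident_Sym dec_free_ident[OF assms(1)] by (simp add: Av_m_decr)
  \<comment> \<open>Nonemptiness, witnessed by the loop of \<open>ident k\<close>, excludes the
    default value -1 in \<open>fun_aff_dim\<close>.\<close>
  then have ne: "?P \<noteq> {}"
    using loop_feasible[OF assms(1), of "ident k" k j] by (auto simp: k)
  then have a: "a \<in> ?P" unfolding a_def by (simp add: some_in_eq)
  have "fun_space.dim ((\<lambda>x. x - a) ` ?P) + card (Av_m j (decr n)) = card (Av_m k (decr n))"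
    using span_feasible_differences[OF assms(1), of a j] a dim_closed_flows[OF assms(1), of j]
    by (metis k fun_space.dim_span)
  then show ?thesis
    using ne by (simp add: fun_aff_dim_def a_def k)
qed

end
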